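(* If $P \subseteq \mathbb{R}^2$ is a disjoint union of a finite (positive) number of bounded horizontal line segments such that no two points of $P$ have the same $x$-coordinate and no two of the segments have the same $y$-coordinate, then $\operatorname{opx}(n, P) = O(n)$ as $n \to \infty$ (the constant may depend on $P$).
   Context: Containment for subsets of the plane: for $P, S \subseteq \mathbb{R}^2$, let $X_P, Y_P$ be the sets of $x$-coordinates and $y$-coordinates of points of $P$, and $X_S, Y_S$ likewise for $S$. $S$ contains $P$ if there exist functions $f_X: X_P \to X_S$ and $f_Y: Y_P \to Y_S$ such that (1) $\frac{f_X(x_0)-f_X(x_1)}{x_0-x_1} \ge 1$ for all $x_0 > x_1$ in $X_P$; (2) $\frac{f_Y(y_0)-f_Y(y_1)}{y_0-y_1} \ge 1$ for all $y_0 > y_1$ in $Y_P$; (3) $(f_X(x), f_Y(y)) \in S$ for all $(x,y) \in P$. Otherwise $S$ is $P$-free. For real $n > 0$, $\operatorname{opx}(n,P)$ is the supremum of the Lebesgue measure $\mu_2(S)$ over all open (in $\mathbb{R}^2$) $P$-free subsets $S \subseteq [0,n]^2$. $f(n) = O(g(n))$ means there is a constant $C > 0$ with $f(n) \le C g(n)$ for all sufficiently large real $n$. *)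

theory Defs
  imports "HOL-Analysis.Analysis" "HOL-Library.Landau_Symbols"
begin

definition expanding_on :: "real set \<Rightarrow> (real \<Rightarrow> real) \<Rightarrow> bool" where
  "expanding_on A f \<longleftrightarrow>
     (\<forall>x0\<in>A. \<forall>x1\<in>A. x0 > x1 \<longrightarrow> (f x0 - f x1) / (x0 - x1) \<ge> 1)"

definition pattern_contains :: "(real \<times> real) set \<Rightarrow> (real \<times> real) set \<Rightarrow> bool" where
  "pattern_contains S P \<longleftrightarrow>
     (\<exists>fX \<in> fst ` P \<rightarrow> fst ` S. \<exists>fY \<in> snd ` P \<rightarrow> snd ` S.
        expanding_on (fst ` P) fX \<and> expanding_on (snd ` P) fY \<and>
        (\<forall>(x, y)\<in>P. (fX x, fY y) \<in> S))"

abbreviation pattern_free :: "(real \<times> real) set \<Rightarrow> (real \<times> real) set \<Rightarrow> bool" where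
  "pattern_free S P \<equiv> \<not> pattern_contains S P"

text \<open>For nonempty \<open>P\<close> the empty set is \<open>P\<close>-free, and all the measures are at most \<open>n\<^sup>2\<close>;
  so for \<open>n > 0\<close> this is the supremum of a nonempty bounded set of reals.\<close>

definition opx :: "real \<Rightarrow> (real \<times> real) set \<Rightarrow> real" where
  "opx n P = Sup {measure lebesgue S | S. open S \<and> S \<subseteq> {0..n} \<times> {0..n} \<and> pattern_free S P}"

text \<open>A bounded segment may contain both, one or none of its endpoints, and may
  degenerate to a single point.\<close>

definition horizontal_segment :: "(real \<times> real) set \<Rightarrow> bool" where
  "horizontal_segment L \<longleftrightarrow>
     (\<exists>I y. is_interval I \<and> bounded I \<and> I \<noteq> {} \<and> L = I \<times> {y})"

end

theory Submission
  imports Defs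
begin

text \<open>Let \<open>D\<close> bound the extent of \<open>P\<close> in both directions. For each \<open>v\<close>, take the slices of \<open>S\<close> at the
  heights \<open>v + j * D\<close> and cut each of them into pieces of measure about \<open>4 * D\<close>. Each piece has room for
  any segment of \<open>P\<close>, since a segment embeds expandingly into every set of larger measure. Rounded to
  columns of width \<open>D\<close>, the pieces are disjoint integer intervals in integer rows, and if these
  intervals contain the permutation pattern of the segments, then \<open>S\<close> contains \<open>P\<close>. An adaptation of
  the Marcus--Tardos argument from matrix entries to intervals shows that the number of pieces is
  linear in the number of rows and columns; integrating over \<open>v\<close> bounds the measure of \<open>S\<close>.\<close>

section \<open>Interval configurations avoiding a permutation pattern\<close>

lemma card_eq_sum_fibres:
  assumes "finite A" "finite B" "f ` A \<subseteq> B"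
  shows "card A = (\<Sum>y\<in>B. card {x\<in>A. f x = y})"
proof -
  have "card A = (\<Sum>x\<in>A. 1)" by simp
  also have "\<dots> = (\<Sum>y\<in>B. \<Sum>x\<in>{x\<in>A. f x = y}. 1)"
    using sum.group[OF assms, of "\<lambda>_. 1::nat"] by simp
  finally show ?thesis by simp
qed

lemma card_le_fibres:
  assumes "finite A" "finite B" "f ` A \<subseteq> B" "\<And>y. y \<in> B \<Longrightarrow> card {x\<in>A. f x = y} \<le> c"
  shows "card A \<le> c * card B"
proof -
  have "(\<Sum>y\<in>B. card {x\<in>A. f x = y}) \<le> (\<Sum>y\<in>B. c)"
    by (rule sum_mono) (use assms in auto)
  then show ?thesis using card_eq_sum_fibres[OF assms(1-3)] by (simp add: mult.commute)
qed

text \<open>Sorting the values of \<open>f\<close> and pulling them back gives the enumeration. It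
  turns lower bounds on cardinalities into increasing families of rows or endpoints, indexed by the
  ranks \<open>p\<close> and \<open>q\<close> of the pattern.\<close>

lemma inj_on_enumerate:
  fixes f :: "'a \<Rightarrow> nat"
  assumes "finite A" "inj_on f A" "m \<le> card A"
  obtains e where "\<And>i. i < m \<Longrightarrow> e i \<in> A" "\<And>i j. i < j \<Longrightarrow> j < m \<Longrightarrow> f (e i) < f (e j)"
proof -
  define xs where "xs = sorted_list_of_set (f ` A)"
  define e where "e i = inv_into A f (xs ! i)" for i
  have len: "length xs = card A"
    unfolding xs_def using assms by (simp add: card_image)
  have set: "set xs = f ` A" unfolding xs_def using assms by simp
  have mem: "xs ! i \<in> f ` A" if "i < m" for i
    using that assms(3) len set by (metis nth_mem order_less_le_trans)
  have fe: "f (e i) = xs ! i" if "i < m" for i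
    unfolding e_def using mem[OF that] by (rule f_inv_into_f)
  show thesis
  proof
    show "e i \<in> A" if "i < m" for i
      unfolding e_def using mem[OF that] by (rule inv_into_into)
    show "f (e i) < f (e j)" if "i < j" "j < m" for i j
    proof -
      have "xs ! i < xs ! j"
        using sorted_wrt_nth_less[of "(<)" xs i j] that assms(3) len
        unfolding xs_def by simp
      then show ?thesis using fe that by simp
    qed
  qed
qed

lemma card_le_one: "finite A \<Longrightarrow> (\<And>x y. x \<in> A \<Longrightarrow> y \<in> A \<Longrightarrow> x = y) \<Longrightarrow> card A \<le> 1"
  by (simp add: card_le_Suc0_iff_eq)

text \<open>An element \<open>u\<close> of \<open>U\<close> stands for the interval \<open>{a u..b u}\<close> of columns in row \<open>r u\<close>. The
  pattern is given by an index set \<open>I\<close> with its horizontal order \<open>p\<close> and its vertical order \<open>q\<close>.\<close>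

definition separated :: "'u set \<Rightarrow> ('u \<Rightarrow> nat) \<Rightarrow> ('u \<Rightarrow> nat) \<Rightarrow> bool" where
  "separated U a b \<longleftrightarrow> (\<forall>u\<in>U. \<forall>v\<in>U. u \<noteq> v \<longrightarrow> b u < a v \<or> b v < a u)"

definition packed :: "'u set \<Rightarrow> ('u \<Rightarrow> nat) \<Rightarrow> ('u \<Rightarrow> nat) \<Rightarrow> ('u \<Rightarrow> nat) \<Rightarrow> bool" where
  "packed U r a b \<longleftrightarrow> (\<forall>u\<in>U. a u \<le> b u) \<and> (\<forall>x. separated {u\<in>U. r u = x} a b)"

text \<open>Only strict inequalities are transported, and no distances. This makes the notion stable
  under coarsening: an occurrence among merged rows or columns is already one among the original
  ones.\<close>

definition occurs :: "'i set \<Rightarrow> ('i \<Rightarrow> nat) \<Rightarrow> ('i \<Rightarrow> nat) \<Rightarrow>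
    'u set \<Rightarrow> ('u \<Rightarrow> nat) \<Rightarrow> ('u \<Rightarrow> nat) \<Rightarrow> ('u \<Rightarrow> nat) \<Rightarrow> bool" where
  "occurs I p q U r a b \<longleftrightarrow> (\<exists>\<phi>. (\<forall>i\<in>I. \<phi> i \<in> U) \<and>
     (\<forall>i\<in>I. \<forall>j\<in>I. (p i < p j \<longrightarrow> b (\<phi> i) < a (\<phi> j)) \<and> (q i < q j \<longrightarrow> r (\<phi> i) < r (\<phi> j))))"

lemma separatedD: "separated U a b \<Longrightarrow> u \<in> U \<Longrightarrow> v \<in> U \<Longrightarrow> u \<noteq> v \<Longrightarrow> b u < a v \<or> b v < a u"
  by (auto simp: separated_def)

lemma packed_le: "packed U r a b \<Longrightarrow> u \<in> U \<Longrightarrow> a u \<le> b u"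
  by (auto simp: packed_def)

lemma packedD:
  "packed U r a b \<Longrightarrow> u \<in> U \<Longrightarrow> v \<in> U \<Longrightarrow> r u = r v \<Longrightarrow> u \<noteq> v \<Longrightarrow> b u < a v \<or> b v < a u"
  using separatedD[of "{w\<in>U. r w = r v}" a b u v] unfolding packed_def by simp

lemma packed_meet_eq:
  "packed U r a b \<Longrightarrow> u \<in> U \<Longrightarrow> v \<in> U \<Longrightarrow> r u = r v \<Longrightarrow>
   a u \<le> x \<Longrightarrow> x \<le> b u \<Longrightarrow> a v \<le> x \<Longrightarrow> x \<le> b v \<Longrightarrow> u = v"
  using packedD[of U r a b u v] by linarith

lemma packed_subset: "packed U r a b \<Longrightarrow> V \<subseteq> U \<Longrightarrow> packed V r a b"
  unfolding packed_def separated_def by (simp add: subset_iff)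

lemma occurs_subset: "occurs I p q V r a b \<Longrightarrow> V \<subseteq> U \<Longrightarrow> occurs I p q U r a b"
  unfolding occurs_def by (elim ex_forward) (simp add: subset_iff)

lemma div_less_imp_less: "m div s < n div s \<Longrightarrow> m < (n::nat)"
  by (metis div_le_mono leD linorder_le_less_linear)

text \<open>Since \<open>div\<close> is monotone, a strict inequality between quotients forces one
  between the original numbers. Contracting rows or columns therefore creates no new
  occurrence.\<close>

lemma occurs_div_row: "occurs I p q U (\<lambda>u. r u div s) a b \<Longrightarrow> occurs I p q U r a b"
  unfolding occurs_def by (elim ex_forward) (use div_less_imp_less in blast)

lemma occurs_div_col:
  "occurs I p q U r (\<lambda>u. a u div s) (\<lambda>u. b u div s) \<Longrightarrow> occurs I p q U r a b"
  unfolding occurs_def by (elim ex_forward) (use div_less_imp_less in blast)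

section \<open>Greedy selection; contraction of rows and columns\<close>

text \<open>The usual greedy choice: take an interval \<open>v\<close> with smallest right endpoint,
  drop all intervals that start at or before \<open>b v\<close>, and recurse. By minimality of
  \<open>b v\<close>, each dropped interval contains it, so the chosen right endpoints stab the
  whole family.\<close>

lemma greedy_intervals:
  assumes "finite U" "\<And>u. u \<in> U \<Longrightarrow> a u \<le> b u"
  shows "\<exists>V\<subseteq>U. separated V a b \<and> (\<forall>u\<in>U. \<exists>v\<in>V. a u \<le> b v \<and> b v \<le> b u)"
  using assms
proof (induction "card U" arbitrary: U rule: less_induct)
  case less
  show ?case
  proof (cases "U = {}")
    case True
    then show ?thesis by (auto simp: separated_def)
  next
    case False
    then obtain v where v: "v \<in> U" "\<And>u. u \<in> U \<Longrightarrow> b v \<le> b u"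
      using arg_min_if_finite[OF less.prems(1), of b] by (metis leI)
    define T where "T = {u\<in>U. b v < a u}"
    have "T \<subset> U" unfolding T_def using v(1) less.prems(2)[OF v(1)] by (metis (mono_tags, lifting) leD mem_Collect_eq psubsetI subsetI)
    then have "card T < card U" using less.prems by (simp add: psubset_card_mono)
    then obtain V where V: "V \<subseteq> T" "separated V a b" "\<forall>u\<in>T. \<exists>v\<in>V. a u \<le> b v \<and> b v \<le> b u"
      using less.hyps[of T] less.prems unfolding T_def by auto
    have "insert v V \<subseteq> U" using V v unfolding T_def by auto
    moreover have "separated (insert v V) a b"
      using V(1,2) unfolding separated_def T_def by auto
    moreover have "\<forall>u\<in>U. \<exists>v\<in>insert v V. a u \<le> b v \<and> b v \<le> b u"
    proof
      fix u assume "u \<in> U"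
      then show "\<exists>v\<in>insert v V. a u \<le> b v \<and> b v \<le> b u"
        using V(3) v(2)[of u] by (cases "u \<in> T") (auto simp: T_def)
    qed
    ultimately show ?thesis by blast
  qed
qed

text \<open>Glues selections made independently on the fibres of \<open>f\<close>. The
  multiplicative loss \<open>c\<close> survives unchanged, and the additive loss \<open>d\<close> is
  paid once per fibre. The fibres will be blocks of rows in one use and single rows in the
  other.\<close>

lemma select_fibrewise:
  assumes "finite U" "finite B" "f ` U \<subseteq> B"
    and "\<And>y. y \<in> B \<Longrightarrow> \<exists>V\<subseteq>{u\<in>U. f u = y}. Q V \<and> card {u\<in>U. f u = y} \<le> c * card V + d"
  shows "\<exists>V\<subseteq>U. (\<forall>y\<in>B. Q {v\<in>V. f v = y}) \<and> card U \<le> c * card V + card B * d"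
proof -
  have "\<forall>y\<in>B. \<exists>V. V \<subseteq> {u\<in>U. f u = y} \<and> Q V \<and> card {u\<in>U. f u = y} \<le> c * card V + d"
    using assms(4) by blast
  from bchoice[OF this] obtain W where
    W: "W y \<subseteq> {u\<in>U. f u = y}" "Q (W y)" "card {u\<in>U. f u = y} \<le> c * card (W y) + d"
    if "y \<in> B" for y
    by auto
  define V where "V = (\<Union>y\<in>B. W y)"
  have VW: "{v\<in>V. f v = y} = W y" if "y \<in> B" for y
    unfolding V_def using W(1) that by auto
  have VU: "V \<subseteq> U" unfolding V_def using W(1) by blast
  have "card U = (\<Sum>y\<in>B. card {u\<in>U. f u = y})"
    by (rule card_eq_sum_fibres) (use assms in auto)
  also have "\<dots> \<le> (\<Sum>y\<in>B. c * card (W y) + d)" by (rule sum_mono) (use W in auto)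
  also have "\<dots> = c * (\<Sum>y\<in>B. card {v\<in>V. f v = y}) + card B * d"
    using VW by (simp add: sum.distrib sum_distrib_left)
  also have "(\<Sum>y\<in>B. card {v\<in>V. f v = y}) = card V"
    by (rule card_eq_sum_fibres[symmetric]) (use VU assms finite_subset in auto)
  finally show ?thesis using VU VW W(2) by (intro exI[of _ V]) simp
qed

text \<open>Each interval is charged to the first endpoint \<open>b v\<close> of the greedy family \<open>V\<close> that it contains. If
  \<open>2 * k\<close> endpoints are charged from the same \<open>k\<close> rows, the pattern occurs: in each row the interval
  charged to an endpoint starts after the previous endpoint and ends before the next one, so
  using every second endpoint keeps the chosen intervals apart.\<close>

lemma row_group:
  assumes fin: "finite U" and pk: "packed U r a b" and no: "\<not> occurs I p q U r a b"
    and p: "\<And>i. i \<in> I \<Longrightarrow> p i < k" and q: "\<And>i. i \<in> I \<Longrightarrow> q i < k"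
    and X: "finite X" "card X = s" "r ` U \<subseteq> X"
  shows "\<exists>V\<subseteq>U. separated V a b \<and> card U \<le> k * card V + 2 * k * s * 2 ^ s"
proof -
  obtain V where V: "V \<subseteq> U" "separated V a b" and
    stab: "\<forall>u\<in>U. \<exists>v\<in>V. a u \<le> b v \<and> b v \<le> b u"
    using greedy_intervals[of U a b, OF fin packed_le[OF pk]] by blast
  have finV: "finite V" using V fin finite_subset by auto
  have binj: "inj_on b V"
  proof (rule inj_onI, rule ccontr)
    fix v w assume vw: "v \<in> V" "w \<in> V" "b v = b w" "v \<noteq> w"
    then have "v \<in> U" "w \<in> U" using V(1) by auto
    then show False
      using separatedD[OF V(2) vw(1,2,4)] packed_le[OF pk, of v] packed_le[OF pk, of w] vw(3) by auto
  qed
  have "\<forall>u\<in>U. \<exists>v. v \<in> V \<and> a u \<le> b v \<and> b v \<le> b u \<and> (\<forall>w\<in>V. b w < b v \<longrightarrow> b w < a u)"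
  proof
    fix u assume "u \<in> U"
    let ?T = "{v\<in>V. a u \<le> b v \<and> b v \<le> b u}"
    have "finite ?T" "?T \<noteq> {}" using finV bspec[OF stab \<open>u \<in> U\<close>] by auto
    then obtain v where v: "v \<in> ?T" "\<not> (\<exists>w\<in>?T. b w < b v)"
      using arg_min_if_finite[of ?T b] by blast
    have "b w < a u" if "w \<in> V" "b w < b v" for w
    proof (rule ccontr)
      assume "\<not> b w < a u"
      then have "w \<in> ?T" using that v(1) by simp
      then show False using v(2) that(2) by blast
    qed
    then show "\<exists>v. v \<in> V \<and> a u \<le> b v \<and> b v \<le> b u \<and> (\<forall>w\<in>V. b w < b v \<longrightarrow> b w < a u)"
      using v(1) by blast
  qed
  from bchoice[OF this] obtain h where hall: "\<forall>u\<in>U. h u \<in> V \<and> a u \<le> b (h u) \<and> b (h u) \<le> b u \<and>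
      (\<forall>w\<in>V. b w < b (h u) \<longrightarrow> b w < a u)" by blast
  have h: "h u \<in> V" "a u \<le> b (h u)" "b (h u) \<le> b u"
      "\<And>w. w \<in> V \<Longrightarrow> b w < b (h u) \<Longrightarrow> b w < a u" if "u \<in> U" for u
    using bspec[OF hall that] by auto
  define F where "F v = {u\<in>U. h u = v}" for v
  \<comment> \<open>All intervals charged to \<open>v\<close> contain the column \<open>b v\<close>,
    so a row contributes at most one of them.\<close>
  have rinj: "inj_on r (F v)" for v
  proof (rule inj_onI)
    fix u w assume "u \<in> F v" "w \<in> F v" "r u = r w"
    then show "u = w" using h[of u] h[of w] packed_meet_eq[OF pk, of u w "b v"] unfolding F_def by auto
  qed
  have rF: "r ` F v \<subseteq> X" for v unfolding F_def using X by auto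
  have Fs: "card (F v) \<le> s" for v
    using card_inj_on_le[OF rinj rF X(1)] X(2) by simp
  define T where "T = {v\<in>V. k \<le> card (F v)}"
  have finT: "finite T" unfolding T_def using finV by simp
  \<comment> \<open>\<open>T\<close> holds the overloaded endpoints. They are classified by the set
    of rows from which they are charged, which has at most \<open>2 ^ s\<close> possible
    values.\<close>
  have "card T \<le> 2 * k * card (Pow X)"
  proof (rule card_le_fibres[where f = "\<lambda>v. r ` F v"])
    show "(\<lambda>v. r ` F v) ` T \<subseteq> Pow X" using rF by auto
    fix Y assume "Y \<in> Pow X"
    let ?A = "{v\<in>T. r ` F v = Y}"
    show "card ?A \<le> 2 * k"
    proof (rule ccontr)
      assume "\<not> card ?A \<le> 2 * k"
      then have "2 * k \<le> card ?A" "card ?A \<noteq> 0" by simp_all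
      then have A: "2 * k \<le> card ?A" "?A \<noteq> {}" by (metis, metis card.empty)
      have "inj_on b ?A" by (rule inj_on_subset[OF binj]) (auto simp: T_def)
      then obtain e where e: "\<And>i. i < 2 * k \<Longrightarrow> e i \<in> ?A"
          "\<And>i j. i < j \<Longrightarrow> j < 2 * k \<Longrightarrow> b (e i) < b (e j)"
        using inj_on_enumerate[of ?A b "2 * k"] finT A by auto
      have eV: "e i \<in> V" if "i < 2 * k" for i using e(1)[OF that] by (auto simp: T_def)
      obtain v0 where "v0 \<in> ?A" using A by blast
      then have "k \<le> card Y" using card_image[OF rinj, of v0] unfolding T_def by auto
      moreover have "finite Y" using \<open>Y \<in> Pow X\<close> X finite_subset by auto
      ultimately obtain y where y: "\<And>i. i < k \<Longrightarrow> y i \<in> Y" "\<And>i j. i < j \<Longrightarrow> j < k \<Longrightarrow> y i < y j"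
        using inj_on_enumerate[of Y id k] by auto
      have "\<exists>u\<in>U. h u = e l \<and> r u = y c" if "l < 2 * k" "c < k" for l c
      proof -
        have "y c \<in> r ` F (e l)" using e(1)[OF that(1)] y(1)[OF that(2)] by auto
        then show ?thesis unfolding F_def by auto
      qed
      then obtain w where w: "w l c \<in> U" "h (w l c) = e l" "r (w l c) = y c"
        if "l < 2 * k" "c < k" for l c by metis
      have left: "b (e l') < a (w l c)" if "l' < l" "l < 2 * k" "c < k" for l l' c
        using h(4)[OF w(1)[OF that(2,3)], of "e l'"] w(2)[OF that(2,3)] eV[of l'] e(2)[of l' l] that by auto
      \<comment> \<open>In row \<open>y c\<close> the intervals charged to \<open>e l\<close> and
        \<open>e (Suc l)\<close> are disjoint. They contain these endpoints in this order, so the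
        first ends before the second begins.\<close>
      have right: "b (w l c) < b (e (Suc l))" if "Suc l < 2 * k" "c < k" for l c
      proof -
        have l: "l < 2 * k" using that by simp
        note w1 = w[OF l that(2)] and w2 = w[OF that]
        have lt: "b (e l) < b (e (Suc l))" using e(2)[of l "Suc l"] that by simp
        have "b (w l c) < a (w (Suc l) c) \<or> b (w (Suc l) c) < a (w l c)"
          by (rule packedD[OF pk]) (use w1 w2 lt in auto)
        then show ?thesis
          using h(2,3)[OF w1(1)] h(2,3)[OF w2(1)] w1(2) w2(2) lt by auto
      qed
      have "occurs I p q U r a b"
        unfolding occurs_def
      proof (intro exI[of _ "\<lambda>i. w (2 * p i) (q i)"] conjI ballI impI)
        fix i assume i: "i \<in> I"
        show "w (2 * p i) (q i) \<in> U" using w(1) p[OF i] q[OF i] by simp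
        fix j assume j: "j \<in> I"
        show "r (w (2 * p i) (q i)) < r (w (2 * p j) (q j))" if "q i < q j"
          using w(3) p[OF i] q[OF i] p[OF j] q[OF j] y(2) that by simp
        assume lt: "p i < p j"
        have "b (w (2 * p i) (q i)) < b (e (Suc (2 * p i)))"
          using right p[OF i] q[OF i] by simp
        also have "\<dots> < a (w (2 * p j) (q j))"
          using left[of "Suc (2 * p i)" "2 * p j" "q j"] lt p[OF j] q[OF j] by simp
        finally show "b (w (2 * p i) (q i)) < a (w (2 * p j) (q j))" .
      qed
      with no show False ..
    qed
  qed (use finT X in auto)
  then have cT: "card T \<le> 2 * k * 2 ^ s" using X by (simp add: card_Pow)
  have "card U = (\<Sum>v\<in>V. card (F v))"
    unfolding F_def by (rule card_eq_sum_fibres) (use fin finV h in auto)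
  \<comment> \<open>Fewer than \<open>k\<close> intervals are charged to an endpoint outside
    \<open>T\<close>, and at most \<open>s\<close> to one in \<open>T\<close>.\<close>
  also have "\<dots> \<le> (\<Sum>v\<in>V. k + (if v \<in> T then s else 0))"
    by (rule sum_mono) (use Fs in \<open>auto simp: T_def intro: trans_le_add2\<close>)
  also have "\<dots> = k * card V + s * card T"
    using finV by (simp add: sum.distrib sum.If_cases T_def Int_def)
  also have "\<dots> \<le> k * card V + s * (2 * k * 2 ^ s)" using cT by simp
  finally have "card U \<le> k * card V + 2 * k * s * 2 ^ s" by (simp add: algebra_simps)
  with V show ?thesis by blast
qed

text \<open>Rows are merged in blocks of \<open>s\<close>. Applying \<open>row_group\<close> to each
  of the \<open>n\<close> blocks costs a factor \<open>k\<close> and an additive loss depending only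
  on \<open>k\<close> and \<open>s\<close>; what is kept stays separated after the merge.\<close>

lemma row_step:
  assumes fin: "finite U" and pk: "packed U r a b" and no: "\<not> occurs I p q U r a b"
    and p: "\<And>i. i \<in> I \<Longrightarrow> p i < k" and q: "\<And>i. i \<in> I \<Longrightarrow> q i < k"
    and s: "s > 0" and r: "\<And>u. u \<in> U \<Longrightarrow> r u < n * s"
  obtains V where "V \<subseteq> U" "packed V (\<lambda>u. r u div s) a b"
    "card U \<le> k * card V + n * (2 * k * s * 2 ^ s)"
proof -
  have sub: "(\<lambda>u. r u div s) ` U \<subseteq> {..<n}"
    using less_mult_imp_div_less r by auto
  have "\<exists>V\<subseteq>{u\<in>U. r u div s = g}. separated V a b \<and>
      card {u\<in>U. r u div s = g} \<le> k * card V + 2 * k * s * 2 ^ s" for g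
  proof (rule row_group[where I = I and p = p and q = q and X = "{g * s..<g * s + s}"])
    show "packed {u\<in>U. r u div s = g} r a b" by (rule packed_subset[OF pk]) auto
    show "\<not> occurs I p q {u\<in>U. r u div s = g} r a b"
      by (rule contrapos_nn[OF no]) (erule occurs_subset, auto)
    show "r ` {u\<in>U. r u div s = g} \<subseteq> {g * s..<g * s + s}"
      using s dividend_less_div_times by (auto simp: add.commute)
  qed (use fin p q in auto)
  then obtain V where V: "V \<subseteq> U" "\<forall>g\<in>{..<n}. separated {v\<in>V. r v div s = g} a b"
     "card U \<le> k * card V + card {..<n} * (2 * k * s * 2 ^ s)"
    using select_fibrewise[OF fin finite_lessThan sub, where Q = "\<lambda>V. separated V a b" and c = k and d = "2 * k * s * 2 ^ s"] by blast
  have "separated {v\<in>V. r v div s = g} a b" for g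
  proof (cases "g < n")
    case False
    then have "{v\<in>V. r v div s = g} = {}" using sub V(1) by auto
    then show ?thesis unfolding separated_def by blast
  qed (use V(2) in auto)
  then have "packed V (\<lambda>u. r u div s) a b"
    using V(1) packed_le[OF pk] unfolding packed_def by auto
  then show thesis using that V by simp
qed

text \<open>Blocks of \<open>s\<close> columns with at least \<open>k\<close> intervals inside are discarded: \<open>k\<close> rows with the same
  right endpoints in one block would give the pattern. In the other blocks at most \<open>k + 1\<close>
  intervals of a row meet a block.\<close>

lemma col_step:
  assumes fin: "finite U" and pk: "packed U r a b" and no: "\<not> occurs I p q U r a b"
    and p: "\<And>i. i \<in> I \<Longrightarrow> p i < k" and q: "\<And>i. i \<in> I \<Longrightarrow> q i < k"
    and s: "s > 0" and b: "\<And>u. u \<in> U \<Longrightarrow> b u < n * s"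
  obtains V where "V \<subseteq> U" "packed V r (\<lambda>u. a u div s) (\<lambda>u. b u div s)"
    "card U \<le> (k + 1) * card V + n * (k * s * 2 ^ s)"
proof -
  define N where "N x c = {u\<in>U. r u = x \<and> a u div s = c \<and> b u div s = c}" for x c
  define R where "R c = {x\<in>r ` U. k \<le> card (N x c)}" for c
  have finN: "finite (N x c)" for x c unfolding N_def using fin by simp
  have finR: "finite (R c)" for c unfolding R_def using fin by simp
  have binj: "inj_on b (N x c)" for x c
  proof (rule inj_onI)
    fix u w assume "u \<in> N x c" "w \<in> N x c" "b u = b w"
    then show "u = w"
      using packed_meet_eq[OF pk, of u w "b u"] packed_le[OF pk, of u] packed_le[OF pk, of w]
      unfolding N_def by auto
  qed
  have bN: "b ` N x c \<subseteq> {c * s..<c * s + s}" for x c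
  proof (rule image_subsetI)
    fix u assume "u \<in> N x c"
    then show "b u \<in> {c * s..<c * s + s}"
      using div_times_less_eq_dividend[of "b u" s] dividend_less_div_times[OF s, of "b u"]
      unfolding N_def by auto
  qed
  have Ns: "card (N x c) \<le> s" for x c
    using card_inj_on_le[OF binj bN] by simp
  have cR: "card (R c) \<le> k * 2 ^ s" for c
  proof -
    have "card (R c) \<le> k * card (Pow {c * s..<c * s + s})"
    proof (rule card_le_fibres[where f = "\<lambda>x. b ` N x c"])
      show "(\<lambda>x. b ` N x c) ` R c \<subseteq> Pow {c * s..<c * s + s}" using bN by auto
      fix Y assume "Y \<in> Pow {c * s..<c * s + s}"
      let ?A = "{x\<in>R c. b ` N x c = Y}"
      show "card ?A \<le> k"
      proof (rule ccontr)
        assume "\<not> card ?A \<le> k"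
        then have "k \<le> card ?A" "card ?A \<noteq> 0" by simp_all
        then have A: "k \<le> card ?A" "?A \<noteq> {}" by (metis, metis card.empty)
        then obtain y where y: "\<And>i. i < k \<Longrightarrow> y i \<in> ?A" "\<And>i j. i < j \<Longrightarrow> j < k \<Longrightarrow> y i < y j"
          using inj_on_enumerate[of ?A id k] finR[of c] by auto
        obtain x0 where "x0 \<in> ?A" using A by blast
        then have "k \<le> card Y" "finite Y" using card_image[OF binj, of x0 c] finN unfolding R_def by auto
        then obtain e where e: "\<And>i. i < k \<Longrightarrow> e i \<in> Y" "\<And>i j. i < j \<Longrightarrow> j < k \<Longrightarrow> e i < e j"
          using inj_on_enumerate[of Y id k] by auto
        have "\<exists>u\<in>U. b u = e l \<and> r u = y c" if "l < k" "c < k" for l c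
          using e(1)[OF that(1)] y(1)[OF that(2)] unfolding N_def by fastforce
        then obtain w where w: "w l c \<in> U" "b (w l c) = e l" "r (w l c) = y c"
          if "l < k" "c < k" for l c by metis
        \<comment> \<open>Two intervals of one row with different right endpoints are disjoint, so
          the later one starts only after the earlier one has ended.\<close>
        have left: "e l' < a (w l c)" if "l' < l" "l < k" "c < k" for l l' c
        proof -
          have l': "l' < k" using that by simp
          have lt: "e l' < e l" using e(2) that by simp
          have "b (w l' c) < a (w l c) \<or> b (w l c) < a (w l' c)"
            by (rule packedD[OF pk]) (use w[OF that(2,3)] w[OF l' that(3)] lt in auto)
          then show ?thesis
            using packed_le[OF pk w(1)[OF l' that(3)]] w(2)[OF that(2,3)] w(2)[OF l' that(3)] lt by auto
        qed
        have "occurs I p q U r a b"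
          unfolding occurs_def
        proof (intro exI[of _ "\<lambda>i. w (p i) (q i)"] conjI ballI impI)
          fix i assume i: "i \<in> I"
          show "w (p i) (q i) \<in> U" using w(1) p[OF i] q[OF i] by simp
          fix j assume j: "j \<in> I"
          show "r (w (p i) (q i)) < r (w (p j) (q j))" if "q i < q j"
            using w(3) p[OF i] q[OF i] p[OF j] q[OF j] y(2) that by simp
          show "b (w (p i) (q i)) < a (w (p j) (q j))" if "p i < p j"
            using left[of "p i" "p j" "q j"] that w(2) p[OF i] q[OF i] p[OF j] q[OF j] by simp
        qed
        with no show False ..
      qed
    qed (use finR in auto)
    then show ?thesis by (simp add: card_Pow)
  qed
  \<comment> \<open>\<open>U1\<close> is the discarded part: per block at most
    \<open>k * 2 ^ s\<close> crowded rows, each with at most \<open>s\<close> intervals inside the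
    block.\<close>
  define U1 where "U1 = (\<Union>c<n. \<Union>x\<in>R c. N x c)"
  define U2 where "U2 = U - U1"
  have "card U1 \<le> (\<Sum>c<n. card (\<Union>x\<in>R c. N x c))"
    unfolding U1_def by (rule card_UN_le) simp
  also have "\<dots> \<le> (\<Sum>c<n. \<Sum>x\<in>R c. card (N x c))"
    by (intro sum_mono card_UN_le finR)
  also have "\<dots> \<le> (\<Sum>c<n. k * 2 ^ s * s)"
  proof (rule sum_mono)
    fix c
    have "(\<Sum>x\<in>R c. card (N x c)) \<le> card (R c) * s" using sum_bounded_above[of "R c" "\<lambda>x. card (N x c)" s] Ns by simp
    also have "\<dots> \<le> k * 2 ^ s * s" using cR[of c] by (rule mult_right_mono) simp
    finally show "(\<Sum>x\<in>R c. card (N x c)) \<le> k * 2 ^ s * s" .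
  qed
  finally have U1: "card U1 \<le> n * (k * s * 2 ^ s)" by (simp add: algebra_simps)
  have fin2: "finite U2" unfolding U2_def using fin by simp
  have pk2: "packed U2 r a b" unfolding U2_def by (rule packed_subset[OF pk]) auto
  have "\<exists>V\<subseteq>{u\<in>U2. r u = x}. separated V (\<lambda>u. a u div s) (\<lambda>u. b u div s) \<and>
      card {u\<in>U2. r u = x} \<le> (k + 1) * card V + 0" if x: "x \<in> r ` U" for x
  proof -
    let ?T = "{u\<in>U2. r u = x}"
    have finT: "finite ?T" using fin2 by simp
    have "a u div s \<le> b u div s" if "u \<in> ?T" for u
      using packed_le[OF pk2] that by (auto intro: div_le_mono)
    from greedy_intervals[of ?T "\<lambda>u. a u div s" "\<lambda>u. b u div s", OF finT this]
    obtain V where V: "V \<subseteq> ?T" "separated V (\<lambda>u. a u div s) (\<lambda>u. b u div s)"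
      "\<forall>u\<in>?T. \<exists>v\<in>V. a u div s \<le> b v div s \<and> b v div s \<le> b u div s" by blast
    from bchoice[OF V(3)[unfolded Bex_def]] obtain h where h: "h u \<in> V" "a u div s \<le> b (h u) div s" "b (h u) div s \<le> b u div s"
      if "u \<in> ?T" for u by blast
    have "card ?T \<le> (k + 1) * card V"
    proof (rule card_le_fibres[where f = h])
      fix v assume "v \<in> V"
      define c where "c = b v div s"
      have "v \<in> U" using \<open>v \<in> V\<close> V(1) unfolding U2_def by auto
      then have cn: "c < n" unfolding c_def using less_mult_imp_div_less b by blast
      \<comment> \<open>The contracted range of every interval represented by \<open>v\<close> meets
        block \<open>c\<close>. Either it lies inside the block (\<open>?A\<close>), or it crosses
        the left (\<open>?B\<close>) or right (\<open>?C\<close>) border of the block. Intervals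
        crossing one border share the column just after it, so in a row there is at most
        one.\<close>
      let ?A = "{u\<in>?T. a u div s = c \<and> b u div s = c}"
      let ?B = "{u\<in>?T. a u div s < c \<and> c \<le> b u div s}"
      let ?C = "{u\<in>?T. a u div s \<le> c \<and> c < b u div s}"
      have cA: "card ?A \<le> k - 1"
      proof (cases "x \<in> R c")
        case True
        then have "?A = {}" using cn unfolding U2_def U1_def N_def by auto
        then show ?thesis by (metis card.empty zero_le)
      next
        case False
        then have "card (N x c) < k" using x unfolding R_def by auto
        moreover have "card ?A \<le> card (N x c)"
          by (rule card_mono[OF finN]) (auto simp: N_def U2_def)
        ultimately show ?thesis by linarith
      qed
      have cross: "card {u\<in>?T. a u div s < d \<and> d \<le> b u div s} \<le> 1" for d
      proof (rule card_le_one)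
        fix u w assume "u \<in> {u\<in>?T. a u div s < d \<and> d \<le> b u div s}"
          "w \<in> {u\<in>?T. a u div s < d \<and> d \<le> b u div s}"
        then have uw: "u \<in> U2" "w \<in> U2" "r u = r w" "a u < d * s" "a w < d * s"
            "d * s \<le> b u" "d * s \<le> b w"
          using s by (auto simp: less_eq_div_iff_mult_less_eq div_less_iff_less_mult)
        then show "u = w" using packed_meet_eq[OF pk2, of u w "d * s"] by simp
      qed (use fin2 in simp)
      have cB: "card ?B \<le> 1" using cross[of c] .
      have cC: "card ?C \<le> 1" using cross[of "Suc c"] by (simp add: less_Suc_eq_le Suc_le_eq)
      \<comment> \<open>Needed because \<open>k - 1\<close> is truncated subtraction. For
        \<open>k = 0\<close> the pattern is empty and occurs trivially.\<close>
      have k: "k > 0"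
      proof (rule ccontr)
        assume "\<not> k > 0"
        then have "I = {}" using p by auto
        then show False using no by (simp add: occurs_def)
      qed
      have "{u\<in>?T. h u = v} \<subseteq> ?A \<union> ?B \<union> ?C" using h unfolding c_def by force
      then have "card {u\<in>?T. h u = v} \<le> card (?A \<union> ?B \<union> ?C)" using fin2 by (intro card_mono) simp_all
      also have "\<dots> \<le> card ?A + card ?B + card ?C"
        using card_Un_le[of "?A \<union> ?B" ?C] card_Un_le[of ?A ?B] by linarith
      also have "\<dots> \<le> k + 1" using cA cB cC k by linarith
      finally show "card {u\<in>?T. h u = v} \<le> k + 1" .
    qed (use finT V h finite_subset in auto)
    then show ?thesis using V by auto
  qed
  moreover have "r ` U2 \<subseteq> r ` U" unfolding U2_def by auto
  ultimately obtain V where V: "V \<subseteq> U2"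
      "\<forall>x\<in>r ` U. separated {v\<in>V. r v = x} (\<lambda>u. a u div s) (\<lambda>u. b u div s)"
      "card U2 \<le> (k + 1) * card V + card (r ` U) * 0"
    using select_fibrewise[of U2 "r ` U" r "\<lambda>V. separated V (\<lambda>u. a u div s) (\<lambda>u. b u div s)" "k + 1" 0] fin fin2
    by blast
  have VU: "V \<subseteq> U" using V unfolding U2_def by auto
  have "separated {v\<in>V. r v = x} (\<lambda>u. a u div s) (\<lambda>u. b u div s)" for x
  proof (cases "x \<in> r ` U")
    case False
    then have "{v\<in>V. r v = x} = {}" using VU by auto
    then show ?thesis unfolding separated_def by blast
  qed (use V(2) in auto)
  then have "packed V r (\<lambda>u. a u div s) (\<lambda>u. b u div s)"
    using VU packed_le[OF pk] unfolding packed_def by (auto intro: div_le_mono)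
  moreover have "card U \<le> card U2 + card U1"
  proof -
    have "finite U1" unfolding U1_def using finR finN by blast
    then have "card U \<le> card (U2 \<union> U1)" using fin2 by (intro card_mono) (auto simp: U2_def)
    then show ?thesis using card_Un_le[of U2 U1] by linarith
  qed
  ultimately show thesis using that[OF VU] V(3) U1 by simp
qed

section \<open>Recursion on the grid size\<close>

text \<open>A row step followed by a column step shrinks the grid by the factor \<open>s\<close> and
  costs a factor \<open>k * (k + 1)\<close> plus a multiple of \<open>s ^ m\<close>. As
  \<open>s\<close> exceeds \<open>k * (k + 1)\<close> by one, the surplus \<open>C * s ^ m\<close>
  absorbs that additive term; this dictates both constants.\<close>

lemma card_power_bound:
  assumes p: "\<And>i. i \<in> I \<Longrightarrow> p i < k" and q: "\<And>i. i \<in> I \<Longrightarrow> q i < k"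
    and s: "s = k * (k + 1) + 1" and C: "C = 2 * k * s * 2 ^ s + k * (k * s * 2 ^ s) + 1"
  shows "\<lbrakk>finite U; packed U r a b; \<not> occurs I p q U r a b; \<And>u. u \<in> U \<Longrightarrow> r u < s ^ m;
     \<And>u. u \<in> U \<Longrightarrow> b u < s ^ m\<rbrakk> \<Longrightarrow> card U \<le> C * s ^ m"
proof (induction m arbitrary: U r a b)
  case 0
  \<comment> \<open>There is one row and one column here, so all intervals contain column
    \<open>0\<close>.\<close>
  have "u = w" if "u \<in> U" "w \<in> U" for u w
    using packed_meet_eq[OF 0(2) that, of 0] 0(4,5) packed_le[OF 0(2)] that by fastforce
  then have "card U \<le> 1" using card_le_one[OF 0(1)] by blast
  then show ?case using C by simp
next
  case (Suc m)
  have s0: "s > 0" using s by simp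
  obtain V where V: "V \<subseteq> U" "packed V (\<lambda>u. r u div s) a b"
      "card U \<le> k * card V + s ^ m * (2 * k * s * 2 ^ s)"
    using row_step[OF Suc.prems(1-3) p q s0, where n = "s ^ m"] Suc.prems(4) by (auto simp: mult.commute)
  have finV: "finite V" using V Suc.prems finite_subset by auto
  have noV: "\<not> occurs I p q V (\<lambda>u. r u div s) a b"
    by (rule contrapos_nn[OF Suc.prems(3)]) (erule occurs_subset[OF occurs_div_row V(1)])
  have "\<And>u. u \<in> V \<Longrightarrow> b u < s ^ m * s" using Suc.prems(5) V(1) by (auto simp: mult.commute)
  from col_step[OF finV V(2) noV p q s0 this]
  obtain W where W: "W \<subseteq> V" "packed W (\<lambda>u. r u div s) (\<lambda>u. a u div s) (\<lambda>u. b u div s)"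
      "card V \<le> (k + 1) * card W + s ^ m * (k * s * 2 ^ s)" by metis
  have "card W \<le> C * s ^ m"
  proof (rule Suc.IH[OF _ W(2)])
    show "finite W" using W finV finite_subset by auto
    show "\<not> occurs I p q W (\<lambda>u. r u div s) (\<lambda>u. a u div s) (\<lambda>u. b u div s)"
      by (rule contrapos_nn[OF noV]) (erule occurs_subset[OF occurs_div_col W(1)])
    show "r u div s < s ^ m" "b u div s < s ^ m" if "u \<in> W" for u
      using that W(1) V(1) Suc.prems(4,5)[of u]
      by (auto intro!: less_mult_imp_div_less simp: mult.commute[of "s ^ m"])
  qed
  then have "card V \<le> (k + 1) * (C * s ^ m) + s ^ m * (k * s * 2 ^ s)"
    using W(3) by (meson add_le_mono1 le_trans mult_le_mono2)
  then have "card U \<le> k * ((k + 1) * (C * s ^ m) + s ^ m * (k * s * 2 ^ s)) + s ^ m * (2 * k * s * 2 ^ s)"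
    using V(3) by (meson add_le_mono1 le_trans mult_le_mono2)
  also have "\<dots> = k * (k + 1) * C * s ^ m + s ^ m * (2 * k * s * 2 ^ s + k * (k * s * 2 ^ s))"
    by (simp add: algebra_simps)
  also have "\<dots> \<le> k * (k + 1) * C * s ^ m + s ^ m * C"
    unfolding C by (intro add_left_mono mult_left_mono) auto
  also have "\<dots> = C * s ^ m * (k * (k + 1) + 1)" by (simp add: algebra_simps)
  also have "\<dots> = C * s ^ Suc m" using s by (simp add: algebra_simps)
  finally show ?case .
qed

text \<open>The grid is enlarged to the next power of \<open>s\<close>, which costs one more factor
  \<open>s\<close>.\<close>

lemma card_linear_bound:
  assumes p: "\<And>i. i \<in> I \<Longrightarrow> p i < k" and q: "\<And>i. i \<in> I \<Longrightarrow> q i < k"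
  obtains C where "\<And>U r a b n. \<lbrakk>finite U; packed U r a b; \<not> occurs I p q U r a b;
     \<And>u. u \<in> U \<Longrightarrow> r u < n; \<And>u. u \<in> U \<Longrightarrow> b u < n\<rbrakk> \<Longrightarrow> card U \<le> C * n"
proof -
  define s where "s = k * (k + 1) + 1"
  define C where "C = 2 * k * s * 2 ^ s + k * (k * s * 2 ^ s) + 1"
  show thesis
  proof (rule that[of "C * s"])
    fix U r a b n
    assume U: "finite U" "packed U r a b" "\<not> occurs I p q U r a b"
      "\<And>u. u \<in> U \<Longrightarrow> r u < n" "\<And>u. u \<in> U \<Longrightarrow> b u < n"
    show "card U \<le> C * s * n"
    proof (cases "U = {}")
      case False
      then have n: "n > 0" using U(4) by fastforce
      have "k > 0"
      proof (rule ccontr)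
        assume "\<not> k > 0"
        then have "I = {}" using p by auto
        then show False using U(3) by (simp add: occurs_def)
      qed
      then have s: "s \<ge> 2" unfolding s_def by (cases k) auto
      then obtain m where m: "s ^ m \<le> n" "n < s ^ (m + 1)" using ex_power_ivl1[OF s, of n] n by auto
      have "card U \<le> C * s ^ (m + 1)"
        by (rule card_power_bound[OF p q s_def C_def U(1-3)]) (use U m in force)+
      also have "\<dots> \<le> C * s * n" using m(1) by simp
      finally show ?thesis .
    qed simp
  qed
qed

section \<open>From measurable slices to intervals\<close>

text \<open>The measure of \<open>K\<close> up to \<open>t\<close> is 1-Lipschitz in
  \<open>t\<close>, so it takes the value \<open>v\<close>.\<close>

lemma compact_prefix_measure:
  fixes K :: "real set"
  assumes K: "compact K" and v: "0 < v" "v \<le> measure lebesgue K"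
  shows "\<exists>t\<in>K. measure lebesgue (K \<inter> {..t}) = v"
proof -
  define F where "F t = measure lebesgue (K \<inter> {..t})" for t
  have lm: "K \<inter> {..t} \<in> lmeasurable" for t
    by (intro lmeasurable_compact compact_Int_closed K closed_atMost)
  have mono: "F s \<le> F t" if "s \<le> t" for s t
    unfolding F_def by (rule measure_mono_fmeasurable) (use that lm in \<open>auto simp: fmeasurableD\<close>)
  have lip: "F t \<le> F s + (t - s)" if "s \<le> t" for s t
  proof -
    have "F t \<le> measure lebesgue ((K \<inter> {..s}) \<union> {s..t})"
      unfolding F_def by (rule measure_mono_fmeasurable) (use lm in \<open>auto simp: fmeasurableD fmeasurable.Un\<close>)
    also have "\<dots> \<le> F s + measure lebesgue {s..t}"
      unfolding F_def by (rule measure_Un_le) (use lm in \<open>auto simp: fmeasurableD\<close>)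
    finally show ?thesis using that by simp
  qed
  have cont: "continuous_on A F" for A
  proof (rule continuous_onI)
    fix x e :: real assume "e > 0"
    have "dist (F y) (F x) \<le> dist y x" for y
      using mono[of x y] lip[of x y] mono[of y x] lip[of y x] by (cases "x \<le> y") (auto simp: dist_real_def)
    then show "\<exists>d>0. \<forall>x'\<in>A. dist x' x < d \<longrightarrow> dist (F x') (F x) \<le> e"
      using \<open>e > 0\<close> by (meson less_imp_le order_trans)
  qed
  obtain B where B: "\<And>x. x \<in> K \<Longrightarrow> \<bar>x\<bar> \<le> B"
    using compact_imp_bounded[OF K] unfolding bounded_iff by auto
  define c where "c = \<bar>B\<bar> + 1"
  have "- c < x \<and> x < c" if "x \<in> K" for x using B[OF that] unfolding c_def by linarith
  then have "K \<inter> {..- c} = {}" "K \<inter> {..c} = K" by (force intro: less_imp_le)+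
  then have "F (- c) = 0" "F c = measure lebesgue K" unfolding F_def by auto
  moreover have "- c \<le> c" unfolding c_def by simp
  ultimately obtain t where t: "F t = v"
    using IVT'[of F "- c" v c] cont[of "{- c..c}"] v by auto
  then have ne: "K \<inter> {..t} \<noteq> {}" using v unfolding F_def by auto
  moreover have "compact (K \<inter> {..t})" by (intro compact_Int_closed K closed_atMost)
  \<comment> \<open>The level \<open>t\<close> may fall into a gap of \<open>K\<close>. The largest
    point of \<open>K\<close> up to \<open>t\<close> has the same prefix measure.\<close>
  ultimately obtain u where u: "u \<in> K \<inter> {..t}" "\<forall>x\<in>K \<inter> {..t}. x \<le> u"
    using compact_attains_sup[of "K \<inter> {..t}"] by auto
  then have "K \<inter> {..u} = K \<inter> {..t}" by force
  then have "measure lebesgue (K \<inter> {..u}) = v" using t unfolding F_def by simp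
  then show ?thesis using u(1) by blast
qed

text \<open>A point \<open>x\<close> goes to the point of a compact subset \<open>K\<close> of \<open>T\<close> up to which \<open>K\<close> has measure
  \<open>x\<close> plus a constant.\<close>

lemma expanding_selection:
  fixes T I :: "real set"
  assumes T: "T \<in> sets lebesgue" "bounded T" and I: "I \<subseteq> {c..c + l}" "l \<ge> 0"
    and l: "l < measure lebesgue T"
  shows "\<exists>g. g ` I \<subseteq> T \<and> (\<forall>x0\<in>I. \<forall>x1\<in>I. x1 < x0 \<longrightarrow> x0 - x1 \<le> g x0 - g x1)"
proof -
  have lmT: "T \<in> lmeasurable" using T by (simp add: bounded_set_imp_lmeasurable)
  obtain K where K: "closed K" "K \<subseteq> T" "T - K \<in> lmeasurable"
      "emeasure lebesgue (T - K) < ennreal (measure lebesgue T - l)"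
    using sets_lebesgue_inner_closed[OF T(1), of "measure lebesgue T - l"] l by auto
  have cK: "compact K" using K T bounded_subset compact_eq_bounded_closed by blast
  have "measure lebesgue (T - K) < measure lebesgue T - l"
    using K(3,4) l by (simp add: emeasure_eq_measure2 ennreal_less_iff)
  moreover have "measure lebesgue (T - K) = measure lebesgue T - measure lebesgue K"
    using measurable_measure_Diff[OF lmT _ K(2)] lmeasurable_compact[OF cK] by (simp add: fmeasurableD)
  ultimately have Kl: "l < measure lebesgue K" by simp
  \<comment> \<open>The slack \<open>\<delta>\<close> shifts the prefix measures from
    \<open>{0..l}\<close> up to the top of the range for \<open>K\<close>. In particular they become
    positive, as \<open>compact_prefix_measure\<close> requires.\<close>
  define \<delta> where "\<delta> = measure lebesgue K - l"
  have "\<forall>x\<in>I. \<exists>t. t \<in> K \<and> measure lebesgue (K \<inter> {..t}) = x - c + \<delta>"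
  proof
    fix x assume "x \<in> I"
    then have "0 < x - c + \<delta>" "x - c + \<delta> \<le> measure lebesgue K" using I Kl unfolding \<delta>_def by auto
    from compact_prefix_measure[OF cK this] show "\<exists>t. t \<in> K \<and> measure lebesgue (K \<inter> {..t}) = x - c + \<delta>"
      by blast
  qed
  from bchoice[OF this] obtain g where
    g: "\<forall>x\<in>I. g x \<in> K \<and> measure lebesgue (K \<inter> {..g x}) = x - c + \<delta>" by blast
  have lm: "K \<inter> {..t} \<in> lmeasurable" for t
    by (intro lmeasurable_compact compact_Int_closed cK closed_atMost)
  have "x0 - x1 \<le> g x0 - g x1" if x: "x0 \<in> I" "x1 \<in> I" "x1 < x0" for x0 x1
  proof -
    have lt: "measure lebesgue (K \<inter> {..g x1}) < measure lebesgue (K \<inter> {..g x0})"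
      using g x by auto
    have le: "g x1 \<le> g x0"
    proof (rule ccontr)
      assume "\<not> g x1 \<le> g x0"
      then have "measure lebesgue (K \<inter> {..g x0}) \<le> measure lebesgue (K \<inter> {..g x1})"
        by (intro measure_mono_fmeasurable) (use lm in \<open>auto simp: fmeasurableD\<close>)
      with lt show False by simp
    qed
    \<comment> \<open>The part of \<open>K\<close> between the two images has measure at most their
      distance, while it must account for \<open>x0 - x1\<close>.\<close>
    have "measure lebesgue (K \<inter> {..g x0}) \<le> measure lebesgue ((K \<inter> {..g x1}) \<union> {g x1..g x0})"
      by (rule measure_mono_fmeasurable) (use lm in \<open>auto simp: fmeasurableD fmeasurable.Un\<close>)
    also have "\<dots> \<le> measure lebesgue (K \<inter> {..g x1}) + measure lebesgue {g x1..g x0}"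
      by (rule measure_Un_le) (use lm in \<open>auto simp: fmeasurableD\<close>)
    finally show ?thesis using g x le by auto
  qed
  moreover have "g ` I \<subseteq> T" using g K(2) by auto
  ultimately show ?thesis by blast
qed

section \<open>Cutting slices and folding heights\<close>

text \<open>The cuts are the first columns where the prefix measure reaches the multiples of
  \<open>4 * D\<close>. Between two cuts, at most \<open>D\<close> is lost by overshooting the first
  and at most \<open>D\<close> by omitting the last column, so more than \<open>D\<close> remains.
  The omitted column makes the integer intervals of consecutive pieces disjoint. The summand
  \<open>1\<close> covers the remainder.\<close>

lemma cut_row:
  fixes T :: "real set"
  assumes T: "T \<in> sets lebesgue" "T \<subseteq> {0..<real N * D}" and D: "D > 0"
  shows "\<exists>m \<alpha>. measure lebesgue T \<le> 4 * D * (real m + 1) \<and> (\<forall>i<m. \<alpha> i < \<alpha> (Suc i) \<and> \<alpha> (Suc i) \<le> N \<and>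
     D < measure lebesgue (T \<inter> {real (\<alpha> i) * D..<real (\<alpha> (Suc i) - 1) * D}))"
proof -
  define G where "G c = measure lebesgue (T \<inter> {..<real c * D})" for c :: nat
  have lmI: "T \<inter> X \<in> lmeasurable" if "X \<in> sets lebesgue" for X
  proof -
    have "bounded (T \<inter> X)" using T(2) bounded_subset[of "{0..<real N * D}"] by (auto simp: bounded_Int)
    then show ?thesis using that T(1) by (intro bounded_set_imp_lmeasurable) auto
  qed
  have lm: "T \<inter> {..<x} \<in> lmeasurable" "T \<inter> {x..<y} \<in> lmeasurable" for x y :: real
    by (intro lmI; simp)+
  have split: "G d = G c + measure lebesgue (T \<inter> {real c * D..<real d * D})" if "c \<le> d" for c d
  proof -
    have "real c * D \<le> real d * D" using that D by simp
    then have eq: "T \<inter> {..<real d * D} = (T \<inter> {..<real c * D}) \<union> (T \<inter> {real c * D..<real d * D})"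
      by auto
    show ?thesis unfolding G_def eq
      using lm by (intro measure_Union)
        (auto simp: fmeasurableD fmeasurableD2 simp del: emeasure_completion)
  qed
  have Gmono: "G c \<le> G d" if "c \<le> d" for c d using split[OF that] by simp
  have Gstep: "G (Suc c) \<le> G c + D" for c
  proof -
    have "measure lebesgue (T \<inter> {real c * D..<real (Suc c) * D}) \<le> measure lebesgue {real c * D..<real (Suc c) * D}"
    proof (rule measure_mono_fmeasurable)
      show "{real c * D..<real (Suc c) * D} \<in> lmeasurable"
        by (intro bounded_set_imp_lmeasurable) simp_all
    qed (use lm in \<open>auto simp: fmeasurableD\<close>)
    also have "\<dots> = D" using D by (simp add: algebra_simps)
    finally show ?thesis using split[of c "Suc c"] by simp
  qed
  have "T \<inter> {..<0} = {}" using T(2) by auto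
  then have G0: "G 0 = 0" unfolding G_def by simp
  have "T \<inter> {..<real N * D} = T" using T(2) by auto
  then have GN: "G N = measure lebesgue T" unfolding G_def by simp
  define m where "m = nat \<lfloor>measure lebesgue T / (4 * D)\<rfloor>"
  have m: "real m \<le> measure lebesgue T / (4 * D)" "measure lebesgue T / (4 * D) \<le> real m + 1"
    unfolding m_def using D by auto
  define \<alpha> where "\<alpha> i = (LEAST c. 4 * D * real i \<le> G c)" for i
  have ex: "4 * D * real i \<le> G N" if "i \<le> m" for i
  proof -
    have "4 * D * real i \<le> 4 * D * real m" using that D by simp
    also have "\<dots> \<le> G N" using m(1) D GN by (simp add: field_simps)
    finally show ?thesis .
  qed
  have aN: "\<alpha> i \<le> N" "4 * D * real i \<le> G (\<alpha> i)" if "i \<le> m" for i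
    unfolding \<alpha>_def using ex[OF that] by (rule Least_le, rule LeastI)
  have up: "G (\<alpha> i) \<le> 4 * D * real i + D" for i
  proof (cases "\<alpha> i")
    case 0
    then show ?thesis using G0 D by simp
  next
    case (Suc c)
    then have "\<not> 4 * D * real i \<le> G c" unfolding \<alpha>_def using not_less_Least lessI by metis
    then show ?thesis using Gstep[of c] Suc by simp
  qed
  have "\<alpha> i < \<alpha> (Suc i) \<and> \<alpha> (Suc i) \<le> N \<and>
     D < measure lebesgue (T \<inter> {real (\<alpha> i) * D..<real (\<alpha> (Suc i) - 1) * D})" if "i < m" for i
  proof -
    have S: "4 * D * real i + 4 * D \<le> G (\<alpha> (Suc i))" using aN(2)[of "Suc i"] that by (simp add: algebra_simps)
    have lt: "\<alpha> i < \<alpha> (Suc i)"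
    proof (rule ccontr)
      assume "\<not> ?thesis"
      then show False using Gmono[of "\<alpha> (Suc i)" "\<alpha> i"] up[of i] S D by simp
    qed
    define b where "b = \<alpha> (Suc i) - 1"
    have b: "\<alpha> (Suc i) = Suc b" "\<alpha> i \<le> b" using lt unfolding b_def by auto
    have "D < G b - G (\<alpha> i)" using Gstep[of b] S up[of i] D b(1) by simp
    then show ?thesis using split[OF b(2)] lt aN(1)[of "Suc i"] that unfolding b_def by simp
  qed
  moreover have "measure lebesgue T \<le> 4 * D * (real m + 1)" using m(2) D by (simp add: field_simps)
  ultimately show ?thesis by blast
qed

text \<open>Folds the support modulo \<open>D\<close>: by translation invariance, the integral is at
  most the integral over one period of the sum of the \<open>N\<close> shifts.\<close>

lemma nn_integral_le_periodic_sum: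
  fixes s :: "real \<Rightarrow> ennreal"
  assumes s[measurable]: "s \<in> borel_measurable borel" and D: "D > 0"
    and supp: "\<And>y. s y \<noteq> 0 \<Longrightarrow> 0 \<le> y \<and> y < real N * D"
    and B: "\<And>v. 0 \<le> v \<Longrightarrow> v < D \<Longrightarrow> (\<Sum>j<N. s (v + real j * D)) \<le> B"
  shows "(\<integral>\<^sup>+y. s y \<partial>lborel) \<le> B * ennreal D"
proof -
  have "(\<integral>\<^sup>+y. s y \<partial>lborel) \<le> (\<integral>\<^sup>+y. (\<Sum>j<N. s y * indicator {0..<D} (y - real j * D)) \<partial>lborel)"
  proof (rule nn_integral_mono)
    fix y
    show "s y \<le> (\<Sum>j<N. s y * indicator {0..<D} (y - real j * D))"
    proof (cases "s y = 0")
      case False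
      then have y: "0 \<le> y" "y < real N * D" using supp by auto
      \<comment> \<open>The index of the period containing \<open>y\<close>; its summand alone
        equals \<open>s y\<close>.\<close>
      define j where "j = nat \<lfloor>y / D\<rfloor>"
      have "0 \<le> y / D" using y D by simp
      then have "real j = of_int \<lfloor>y / D\<rfloor>" unfolding j_def by simp
      then have j: "real j \<le> y / D" "y / D < real j + 1" by linarith+
      then have "real j * D \<le> y" "y < (real j + 1) * D"
        using D by (simp_all add: pos_le_divide_eq pos_divide_less_eq)
      then have "y - real j * D \<in> {0..<D}" by (simp add: algebra_simps)
      moreover have "j < N"
      proof -
        have "y / D < real N" using y(2) D by (simp add: pos_divide_less_eq)
        then have "real j < real N" using j(1) by linarith
        then show ?thesis by simp
      qed
      ultimately show ?thesis
        using member_le_sum[of j "{..<N}" "\<lambda>j. s y * indicator {0..<D} (y - real j * D)"] by simp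
    qed simp
  qed
  also have "\<dots> = (\<Sum>j<N. \<integral>\<^sup>+y. s y * indicator {0..<D} (y - real j * D) \<partial>lborel)"
    by (rule nn_integral_sum) simp
  also have "\<dots> = (\<Sum>j<N. \<integral>\<^sup>+v. s (v + real j * D) * indicator {0..<D} v \<partial>lborel)"
  proof (rule sum.cong[OF refl])
    fix j
    show "(\<integral>\<^sup>+y. s y * indicator {0..<D} (y - real j * D) \<partial>lborel) =
        (\<integral>\<^sup>+v. s (v + real j * D) * indicator {0..<D} v \<partial>lborel)"
      using nn_integral_real_affine[of "\<lambda>y. s y * indicator {0..<D} (y - real j * D)" 1 "real j * D"]
      by (simp add: add.commute)
  qed
  also have "\<dots> = (\<integral>\<^sup>+v. (\<Sum>j<N. s (v + real j * D) * indicator {0..<D} v) \<partial>lborel)"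
    by (rule nn_integral_sum[symmetric]) simp
  also have "\<dots> \<le> (\<integral>\<^sup>+v. B * indicator {0..<D} v \<partial>lborel)"
    by (rule nn_integral_mono) (use B in \<open>auto simp: indicator_def\<close>)
  also have "\<dots> = B * ennreal D" using D by (simp add: nn_integral_cmult_indicator)
  finally show ?thesis .
qed

section \<open>Copies of the pattern from pieces of slices\<close>

text \<open>Each segment is mapped into its own piece by \<open>expanding_selection\<close>.
  Different segments need no further care: coordinates in \<open>P\<close> differ by at most
  \<open>D\<close>, and the images of two segments are at least \<open>D\<close> apart in the right
  order, horizontally and vertically.\<close>

lemma pattern_containsI:
  fixes \<L> :: "'i set"
  assumes P: "P = (\<Union>L\<in>\<L>. J L \<times> {h L})" and D: "D > 0"
    and J: "\<And>L M x x'. L \<in> \<L> \<Longrightarrow> M \<in> \<L> \<Longrightarrow> x \<in> J L \<Longrightarrow> x' \<in> J M \<Longrightarrow> x - x' \<le> D"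
    and h: "\<And>L M. L \<in> \<L> \<Longrightarrow> M \<in> \<L> \<Longrightarrow> h L - h M \<le> D"
    and cross: "\<And>L M. L \<in> \<L> \<Longrightarrow> M \<in> \<L> \<Longrightarrow> L \<noteq> M \<Longrightarrow>
       ((\<forall>x\<in>J L. \<forall>x'\<in>J M. x < x') \<and> \<beta> L + D \<le> \<alpha> M) \<or> ((\<forall>x\<in>J L. \<forall>x'\<in>J M. x' < x) \<and> \<beta> M + D \<le> \<alpha> L)"
    and rows: "\<And>L M. L \<in> \<L> \<Longrightarrow> M \<in> \<L> \<Longrightarrow> L \<noteq> M \<Longrightarrow>
       (h L < h M \<and> t L + D \<le> t M) \<or> (h M < h L \<and> t M + D \<le> t L)"
    and T: "\<And>L. L \<in> \<L> \<Longrightarrow> {x. (x, t L) \<in> S} \<in> sets lebesgue"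
      "\<And>L. L \<in> \<L> \<Longrightarrow> D < measure lebesgue ({x. (x, t L) \<in> S} \<inter> {\<alpha> L..<\<beta> L})"
  shows "pattern_contains S P"
proof -
  have "\<forall>L\<in>\<L>. \<exists>g. g ` J L \<subseteq> {x. (x, t L) \<in> S} \<inter> {\<alpha> L..<\<beta> L} \<and>
      (\<forall>x0\<in>J L. \<forall>x1\<in>J L. x1 < x0 \<longrightarrow> x0 - x1 \<le> g x0 - g x1)"
  proof
    fix L assume L: "L \<in> \<L>"
    have close: "x \<le> x' + D" if "x \<in> J L" "x' \<in> J L" for x x'
      using J[OF L L that] by simp
    have "J L \<subseteq> {Inf (J L)..Inf (J L) + D}"
    proof
      fix x assume x: "x \<in> J L"
      have lower: "x - D \<le> x'" if "x' \<in> J L" for x' using close[OF x that] by simp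
      then have "Inf (J L) \<le> x" using x by (intro cInf_lower bdd_belowI)
      moreover have "x - D \<le> Inf (J L)" using x lower by (intro cInf_greatest) auto
      ultimately show "x \<in> {Inf (J L)..Inf (J L) + D}" by simp
    qed
    then show "\<exists>g. g ` J L \<subseteq> {x. (x, t L) \<in> S} \<inter> {\<alpha> L..<\<beta> L} \<and>
      (\<forall>x0\<in>J L. \<forall>x1\<in>J L. x1 < x0 \<longrightarrow> x0 - x1 \<le> g x0 - g x1)"
      using T[OF L] D by (intro expanding_selection[where c = "Inf (J L)" and l = D]) (auto simp: bounded_Int)
  qed
  from bchoice[OF this] obtain g where g: "\<forall>L\<in>\<L>. g L ` J L \<subseteq> {x. (x, t L) \<in> S} \<inter> {\<alpha> L..<\<beta> L} \<and>
      (\<forall>x0\<in>J L. \<forall>x1\<in>J L. x1 < x0 \<longrightarrow> x0 - x1 \<le> g L x0 - g L x1)" by blast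
  \<comment> \<open>\<open>cross\<close> and \<open>rows\<close> make the segment with a given
    x-coordinate or height unique, so these choices are determined on the projections of
    \<open>P\<close>.\<close>
  define iX where "iX x = (SOME L. L \<in> \<L> \<and> x \<in> J L)" for x
  define iY where "iY y = (SOME L. L \<in> \<L> \<and> h L = y)" for y
  have iX: "iX x = L" if "L \<in> \<L>" "x \<in> J L" for x L
    unfolding iX_def
  proof (rule some_equality)
    fix M assume "M \<in> \<L> \<and> x \<in> J M"
    then show "M = L" using cross[of L M] that by blast
  qed (use that in auto)
  have iY: "iY (h L) = L" if "L \<in> \<L>" for L
    unfolding iY_def
  proof (rule some_equality)
    fix M assume "M \<in> \<L> \<and> h M = h L"
    then show "M = L" using rows[of L M] that by auto
  qed (use that in auto)
  define fX where "fX x = g (iX x) x" for x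
  define fY where "fY y = t (iY y)" for y
  have fX: "fX x = g L x" if "L \<in> \<L>" "x \<in> J L" for x L unfolding fX_def using iX[OF that] by simp
  have fY: "fY (h L) = t L" if "L \<in> \<L>" for L unfolding fY_def using iY[OF that] by simp
  have S: "\<forall>(x, y)\<in>P. (fX x, fY y) \<in> S"
  proof safe
    fix x y assume "(x, y) \<in> P"
    then obtain L where L: "L \<in> \<L>" "x \<in> J L" "y = h L" unfolding P by auto
    then show "(fX x, fY y) \<in> S" using fX[OF L(1,2)] fY[OF L(1)] bspec[OF g L(1)] by auto
  qed
  have eX: "expanding_on (fst ` P) fX"
    unfolding expanding_on_def
  proof (intro ballI impI)
    fix x0 x1 assume x: "x0 \<in> fst ` P" "x1 \<in> fst ` P" "x1 < x0"
    then obtain L M where L: "L \<in> \<L>" "x0 \<in> J L" and M: "M \<in> \<L>" "x1 \<in> J M" unfolding P by auto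
    have "x0 - x1 \<le> fX x0 - fX x1"
    proof (cases "L = M")
      case True
      then show ?thesis using fX[OF L] fX[OF M] bspec[OF g L(1)] L M x by auto
    next
      case False
      then have "\<beta> M + D \<le> \<alpha> L" using cross[OF L(1) M(1)] L M x(3) by fastforce
      moreover have "g L x0 \<in> {\<alpha> L..<\<beta> L}" "g M x1 \<in> {\<alpha> M..<\<beta> M}"
        using bspec[OF g L(1)] bspec[OF g M(1)] L M by auto
      ultimately show ?thesis using fX[OF L] fX[OF M] J[OF L(1) M(1) L(2) M(2)] by simp
    qed
    then show "1 \<le> (fX x0 - fX x1) / (x0 - x1)" using x(3) by simp
  qed
  have eY: "expanding_on (snd ` P) fY"
    unfolding expanding_on_def
  proof (intro ballI impI)
    fix y0 y1 assume y: "y0 \<in> snd ` P" "y1 \<in> snd ` P" "y1 < y0"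
    then obtain L M where L: "L \<in> \<L>" "y0 = h L" and M: "M \<in> \<L>" "y1 = h M" unfolding P by auto
    then have "y0 - y1 \<le> fY y0 - fY y1"
      using rows[OF L(1) M(1)] fY[OF L(1)] fY[OF M(1)] h[OF L(1) M(1)] y(3) by (cases "L = M") auto
    then show "1 \<le> (fY y0 - fY y1) / (y0 - y1)" using y(3) by simp
  qed
  have "fX \<in> fst ` P \<rightarrow> fst ` S" "fY \<in> snd ` P \<rightarrow> snd ` S" using S by force+
  then show ?thesis unfolding pattern_contains_def using S eX eY by blast
qed

text \<open>Ranks replace the real positions of the segments by the natural numbers that
  \<open>occurs\<close> compares.\<close>

lemma rank_less:
  fixes f :: "'i \<Rightarrow> real"
  assumes "finite A" "x \<in> A" "f x < f y"
  shows "card {z\<in>A. f z < f x} < card {z\<in>A. f z < f y}"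
  by (rule psubset_card_mono) (use assms in auto)

lemma rank_bound:
  fixes f :: "'i \<Rightarrow> real"
  assumes "finite A" "x \<in> A"
  shows "card {z\<in>A. f z < f x} < card A"
  by (rule psubset_card_mono) (use assms in auto)

text \<open>For a fixed offset \<open>v\<close>, the pieces from \<open>cut_row\<close> form a
  packed configuration with \<open>N\<close> rows and columns. An occurrence in it would place
  \<open>P\<close> in \<open>S\<close>, so there are at most \<open>C * N\<close> pieces. The
  remainders of the \<open>N\<close> rows turn \<open>C\<close> into \<open>C + 1\<close>.\<close>

lemma pattern_free_row_sum:
  fixes \<L> :: "'i set" and J :: "'i \<Rightarrow> real set" and h :: "'i \<Rightarrow> real"
  assumes P: "P = (\<Union>L\<in>\<L>. J L \<times> {h L})" and D: "D > 0"
    and J: "\<And>L M x x'. L \<in> \<L> \<Longrightarrow> M \<in> \<L> \<Longrightarrow> x \<in> J L \<Longrightarrow> x' \<in> J M \<Longrightarrow> x - x' \<le> D"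
    and h: "\<And>L M. L \<in> \<L> \<Longrightarrow> M \<in> \<L> \<Longrightarrow> h L - h M \<le> D"
    and p: "\<And>L M. L \<in> \<L> \<Longrightarrow> M \<in> \<L> \<Longrightarrow> L \<noteq> M \<Longrightarrow>
       ((\<forall>x\<in>J L. \<forall>x'\<in>J M. x < x') \<and> p L < p M) \<or> ((\<forall>x\<in>J L. \<forall>x'\<in>J M. x' < x) \<and> p M < p L)"
    and q: "\<And>L M. L \<in> \<L> \<Longrightarrow> M \<in> \<L> \<Longrightarrow> L \<noteq> M \<Longrightarrow> (h L < h M \<and> q L < q M) \<or> (h M < h L \<and> q M < q L)"
    and C: "\<And>(U :: (nat \<times> nat) set) r a b n. \<lbrakk>finite U; packed U r a b; \<not> occurs \<L> p q U r a b;
     \<And>u. u \<in> U \<Longrightarrow> r u < n; \<And>u. u \<in> U \<Longrightarrow> b u < n\<rbrakk> \<Longrightarrow> card U \<le> C * n"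
    and S: "open S" "S \<subseteq> {0..n} \<times> {0..n}" "pattern_free S P" and N: "n < real N * D"
  shows "(\<Sum>j<N. measure lebesgue {x. (x, v + real j * D) \<in> S}) \<le> 4 * D * real (C + 1) * real N"
proof -
  define T where "T j = {x. (x, v + real j * D) \<in> S}" for j
  have "open (T j)" for j
    unfolding T_def using open_vimage[OF S(1), of "\<lambda>x. (x, v + real j * D)"]
    by (simp add: vimage_def continuous_intros)
  then have Tm: "T j \<in> sets lebesgue" for j by (simp add: borel_open)
  have Tsub: "T j \<subseteq> {0..<real N * D}" for j unfolding T_def using S(2) N by fastforce
  have "\<forall>j. \<exists>z. measure lebesgue (T j) \<le> 4 * D * (real (fst z) + 1) \<and>
     (\<forall>i<fst z. snd z i < snd z (Suc i) \<and> snd z (Suc i) \<le> N \<and>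
     D < measure lebesgue (T j \<inter> {real (snd z i) * D..<real (snd z (Suc i) - 1) * D}))"
    using cut_row[OF Tm Tsub D] by simp
  from choice[OF this] obtain z where z: "\<forall>j. measure lebesgue (T j) \<le> 4 * D * (real (fst (z j)) + 1) \<and>
     (\<forall>i<fst (z j). snd (z j) i < snd (z j) (Suc i) \<and> snd (z j) (Suc i) \<le> N \<and>
     D < measure lebesgue (T j \<inter> {real (snd (z j) i) * D..<real (snd (z j) (Suc i) - 1) * D}))" ..
  define m where "m j = fst (z j)" for j
  define \<alpha> where "\<alpha> j = snd (z j)" for j
  have m: "measure lebesgue (T j) \<le> 4 * D * (real (m j) + 1)" for j
    unfolding m_def using z by blast
  have \<alpha>: "\<alpha> j i < \<alpha> j (Suc i)" "\<alpha> j (Suc i) \<le> N"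
    "D < measure lebesgue (T j \<inter> {real (\<alpha> j i) * D..<real (\<alpha> j (Suc i) - 1) * D})" if "i < m j" for i j
    using z that unfolding m_def \<alpha>_def by blast+
  have mono: "\<alpha> j i \<le> \<alpha> j i'" if "i \<le> i'" "i' \<le> m j" for i i' j
    using that
  proof (induction i' rule: dec_induct)
    case (step l)
    then show ?case using \<alpha>(1)[of l j] by simp
  qed simp
  define U where "U = (SIGMA j:{..<N}. {..<m j})"
  define a where "a u = \<alpha> (fst u) (snd u)" for u
  define b where "b u = \<alpha> (fst u) (Suc (snd u)) - 1" for u
  have fin: "finite U" unfolding U_def by simp
  have U: "fst u < N" "snd u < m (fst u)" if "u \<in> U" for u using that unfolding U_def by auto
  have ab: "a u \<le> b u" "b u < N" if "u \<in> U" for u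
    using \<alpha>(1,2)[OF U(2)[OF that]] unfolding a_def b_def by auto
  have lt: "b u < a w" if "u \<in> U" "w \<in> U" "fst u = fst w" "snd u < snd w" for u w
    using mono[of "Suc (snd u)" "snd w" "fst u"] \<alpha>(1)[OF U(2)[OF that(1)]] U(2)[OF that(2)] that(3,4)
    unfolding a_def b_def by simp
  have sep: "b u < a w \<or> b w < a u" if "u \<in> U" "w \<in> U" "fst u = fst w" "u \<noteq> w" for u w
  proof -
    have "snd u < snd w \<or> snd w < snd u" using that(3,4) by (meson linorder_neqE_nat prod_eq_iff)
    then show ?thesis using lt[of u w] lt[of w u] that by auto
  qed
  have "packed U fst a b" unfolding packed_def separated_def using ab(1) sep by simp
  moreover have "\<not> occurs \<L> p q U fst a b"
  proof
    assume "occurs \<L> p q U fst a b"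
    then obtain \<phi> where \<phi>: "\<forall>L\<in>\<L>. \<phi> L \<in> U" "\<forall>L\<in>\<L>. \<forall>M\<in>\<L>. (p L < p M \<longrightarrow> b (\<phi> L) < a (\<phi> M)) \<and>
        (q L < q M \<longrightarrow> fst (\<phi> L) < fst (\<phi> M))" unfolding occurs_def by blast
    \<comment> \<open>Distinct integer positions become positions at least \<open>D\<close> apart
      after scaling, which is the separation that \<open>pattern_containsI\<close> asks for.\<close>
    have gap: "real c * D + D \<le> real d * D" if "c < d" for c d :: nat
    proof -
      have "(real c + 1) * D \<le> real d * D" using that D by (intro mult_right_mono) auto
      then show ?thesis by (simp add: algebra_simps)
    qed
    have "pattern_contains S P"
    proof (rule pattern_containsI[OF P D J h, where t = "\<lambda>L. v + real (fst (\<phi> L)) * D"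
          and \<alpha> = "\<lambda>L. real (a (\<phi> L)) * D" and \<beta> = "\<lambda>L. real (b (\<phi> L)) * D"])
      fix L M assume LM: "L \<in> \<L>" "M \<in> \<L>" "L \<noteq> M"
      show "((\<forall>x\<in>J L. \<forall>x'\<in>J M. x < x') \<and> real (b (\<phi> L)) * D + D \<le> real (a (\<phi> M)) * D) \<or>
          ((\<forall>x\<in>J L. \<forall>x'\<in>J M. x' < x) \<and> real (b (\<phi> M)) * D + D \<le> real (a (\<phi> L)) * D)"
        using p[OF LM] \<phi>(2) LM gap by blast
      show "(h L < h M \<and> v + real (fst (\<phi> L)) * D + D \<le> v + real (fst (\<phi> M)) * D) \<or>
          (h M < h L \<and> v + real (fst (\<phi> M)) * D + D \<le> v + real (fst (\<phi> L)) * D)"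
        using q[OF LM] \<phi>(2) LM gap[of "fst (\<phi> L)" "fst (\<phi> M)"] gap[of "fst (\<phi> M)" "fst (\<phi> L)"] by auto
    next
      fix L assume L: "L \<in> \<L>"
      show "{x. (x, v + real (fst (\<phi> L)) * D) \<in> S} \<in> sets lebesgue" using Tm unfolding T_def .
      have "\<phi> L \<in> U" using \<phi>(1) L by blast
      from \<alpha>(3)[OF U(2)[OF this]]
      show "D < measure lebesgue ({x. (x, v + real (fst (\<phi> L)) * D) \<in> S} \<inter>
          {real (a (\<phi> L)) * D..<real (b (\<phi> L)) * D})"
        unfolding a_def b_def T_def .
    qed
    with S(3) show False by simp
  qed
  ultimately have "card U \<le> C * N" using C[OF fin] U(1) ab(2) by blast
  moreover have "card U = (\<Sum>j<N. m j)" unfolding U_def by simp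
  ultimately have sm: "(\<Sum>j<N. real (m j)) \<le> real (C * N)" by (metis of_nat_le_iff of_nat_sum)
  have "(\<Sum>j<N. measure lebesgue (T j)) \<le> (\<Sum>j<N. 4 * D * (real (m j) + 1))"
    by (rule sum_mono) (rule m)
  also have "\<dots> = 4 * D * ((\<Sum>j<N. real (m j)) + real N)"
    by (simp add: sum_distrib_left[symmetric] sum.distrib)
  also have "\<dots> \<le> 4 * D * (real (C * N) + real N)" using sm D by simp
  also have "\<dots> = 4 * D * real (C + 1) * real N" by (simp add: algebra_simps)
  finally show ?thesis unfolding T_def .
qed

section \<open>Integration over the slices\<close>

text \<open>Tonelli gives the measure as the integral of the slice lengths. Folding the heights
  modulo \<open>D\<close> leaves one period of length \<open>D\<close> with integrand at most
  \<open>B\<close>.\<close>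

lemma measure_le_row_sum:
  fixes S :: "(real \<times> real) set"
  assumes S: "open S" "S \<subseteq> {0..n} \<times> {0..n}" and D: "D > 0" and N: "n < real N * D" and B: "B \<ge> 0"
    and rows: "\<And>v. (\<Sum>j<N. measure lebesgue {x. (x, v + real j * D) \<in> S}) \<le> B"
  shows "measure lebesgue S \<le> B * D"
proof -
  define s where "s y = emeasure lborel ((\<lambda>x. (x, y)) -` S)" for y
  have Sb: "S \<in> sets (lborel \<Otimes>\<^sub>M lborel)"
    unfolding lborel_prod sets_lborel using S(1) by (rule borel_open)
  have s[measurable]: "s \<in> borel_measurable borel"
    using lborel_pair.measurable_emeasure_Pair2[OF Sb] unfolding s_def by simp
  have op: "open ((\<lambda>x. (x, y)) -` S)" for y
    by (rule open_vimage[OF S(1)]) (intro continuous_intros)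
  have sub: "(\<lambda>x. (x, y)) -` S \<subseteq> {0..n}" for y using S(2) by auto
  have sm: "s y = ennreal (measure lebesgue {x. (x, y) \<in> S})" for y
  proof -
    have "(\<lambda>x. (x, y)) -` S \<in> lmeasurable"
      using op bounded_subset[OF bounded_closed_interval sub] by (intro bounded_set_imp_lmeasurable) (auto simp: borel_open)
    from emeasure_eq_measure2[OF this] show ?thesis
      unfolding s_def using op[of y] by (simp add: borel_open vimage_def)
  qed
  have "emeasure lborel S = (\<integral>\<^sup>+y. s y \<partial>lborel)"
    unfolding s_def using lborel_pair.emeasure_pair_measure_alt2[OF Sb] by (simp add: lborel_prod)
  also have "\<dots> \<le> ennreal B * ennreal D"
  proof (rule nn_integral_le_periodic_sum[OF s D])
    fix y assume "s y \<noteq> 0"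
    then have "(\<lambda>x. (x, y)) -` S \<noteq> {}" unfolding s_def by (metis emeasure_empty)
    then show "0 \<le> y \<and> y < real N * D" using S(2) N by fastforce
  next
    fix v
    have "(\<Sum>j<N. s (v + real j * D)) = ennreal (\<Sum>j<N. measure lebesgue {x. (x, v + real j * D) \<in> S})"
      unfolding sm by (simp add: sum_ennreal)
    also have "\<dots> \<le> ennreal B" using rows by (rule ennreal_leI)
    finally show "(\<Sum>j<N. s (v + real j * D)) \<le> ennreal B" .
  qed
  also have "\<dots> = ennreal (B * D)" using B D by (simp add: ennreal_mult)
  finally have "measure lborel S \<le> B * D"
    unfolding measure_def using B D by (intro enn2real_leI) auto
  then show ?thesis using S(1) by (simp add: borel_open)
qed

section \<open>Order of the segments and the linear bound\<close>

text \<open>If \<open>y < x\<close>, then either \<open>y\<close> lies between \<open>a\<close> and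
  \<open>x\<close> and so in \<open>A\<close>, or \<open>a\<close> lies between \<open>y\<close> and
  \<open>b\<close> and so in \<open>B\<close>. Hence one representative per segment determines the
  horizontal order.\<close>

lemma disjoint_intervals_less:
  fixes A B :: "real set"
  assumes "is_interval A" "is_interval B" "A \<inter> B = {}" "a \<in> A" "b \<in> B" "a < b" "x \<in> A" "y \<in> B"
  shows "x < y"
proof (rule ccontr)
  assume "\<not> x < y"
  then have "y < x" using assms(3,7,8) by force
  show False
  proof (cases "a \<le> y")
    case True
    then have "y \<in> A" using assms(1,4,7) \<open>y < x\<close> unfolding is_interval_1 by (meson less_imp_le)
    then show False using assms(3,8) by blast
  next
    case False
    then have "a \<in> B" using assms(2,5,6,8) unfolding is_interval_1 by (meson less_imp_le not_le)
    then show False using assms(3,4) by blast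
  qed
qed

theorem theorem4p9:
  fixes P :: "(real \<times> real) set" and \<L> :: "(real \<times> real) set set"
  assumes "finite \<L>" and "\<L> \<noteq> {}"
    and "\<And>L. L \<in> \<L> \<Longrightarrow> horizontal_segment L"
    and "pairwise disjnt \<L>" and "P = \<Union>\<L>"
    and "\<And>p q. p \<in> P \<Longrightarrow> q \<in> P \<Longrightarrow> p \<noteq> q \<Longrightarrow> fst p \<noteq> fst q"
    and "\<And>L M. L \<in> \<L> \<Longrightarrow> M \<in> \<L> \<Longrightarrow> L \<noteq> M \<Longrightarrow> snd ` L \<inter> snd ` M = {}"
  shows "(\<lambda>n. opx n P) \<in> O[at_top](\<lambda>n. n)"
proof -
  have "\<forall>L\<in>\<L>. \<exists>z. is_interval (fst z) \<and> bounded (fst z) \<and> fst z \<noteq> {} \<and> L = fst z \<times> {snd z}"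
    using assms(3) unfolding horizontal_segment_def by simp
  from bchoice[OF this] obtain z where
    z: "\<forall>L\<in>\<L>. is_interval (fst (z L)) \<and> bounded (fst (z L)) \<and> fst (z L) \<noteq> {} \<and> L = fst (z L) \<times> {snd (z L)}" ..
  define J where "J L = fst (z L)" for L
  define h where "h L = snd (z L)" for L
  have J: "is_interval (J L)" "bounded (J L)" "J L \<noteq> {}" and LJ: "L = J L \<times> {h L}" if "L \<in> \<L>" for L
    using z that unfolding J_def h_def by blast+
  define x where "x L = (SOME x. x \<in> J L)" for L
  have x: "x L \<in> J L" if "L \<in> \<L>" for L unfolding x_def using J(3)[OF that] by (simp add: some_in_eq)
  have P: "P = (\<Union>L\<in>\<L>. J L \<times> {h L})" using assms(5) LJ by blast
  have "bounded P" unfolding P using assms(1) J(2) by (intro bounded_UN ballI bounded_Times) auto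
  then have "bounded (fst ` P)" "bounded (snd ` P)"
    by (auto intro: bounded_linear_image bounded_linear_fst bounded_linear_snd)
  then obtain d1 d2 where d1: "\<forall>u\<in>fst ` P. \<bar>u\<bar> \<le> d1" and d2: "\<forall>u\<in>snd ` P. \<bar>u\<bar> \<le> d2"
    unfolding bounded_iff real_norm_def by blast
  \<comment> \<open>This is the larger of \<open>1\<close> and \<open>2 * max d1 d2 + 1\<close>. It
    dominates all coordinate differences in \<open>P\<close>, and being at least \<open>1\<close> it
    gives \<open>n / D \<le> n\<close> below.\<close>
  define D where "D = 2 * max d1 d2 + max 1 (1 - 2 * max d1 d2)"
  have D: "D \<ge> 1" "D \<ge> 2 * d1" "D \<ge> 2 * d2" unfolding D_def by (auto simp: max_def)
  have JD: "u - w \<le> D" if "L \<in> \<L>" "M \<in> \<L>" "u \<in> J L" "w \<in> J M" for L M u w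
  proof -
    have "u \<in> fst ` P" "w \<in> fst ` P" unfolding P using that by force+
    then show ?thesis using bspec[OF d1, of u] bspec[OF d1, of w] D(2) by linarith
  qed
  have hD: "h L - h M \<le> D" if "L \<in> \<L>" "M \<in> \<L>" for L M
  proof -
    have "h L \<in> snd ` P" "h M \<in> snd ` P" unfolding P using x that by force+
    then show ?thesis using bspec[OF d2, of "h L"] bspec[OF d2, of "h M"] D(3) by linarith
  qed
  \<comment> \<open>A common x-coordinate would give two points of \<open>P\<close> above each
    other, distinct because the segments are disjoint.\<close>
  have Jdisj: "J L \<inter> J M = {}" if LM: "L \<in> \<L>" "M \<in> \<L>" "L \<noteq> M" for L M
  proof (rule ccontr)
    assume "J L \<inter> J M \<noteq> {}"
    then obtain u where u: "u \<in> J L" "u \<in> J M" by blast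
    have "(u, h L) \<in> L" "(u, h M) \<in> M" using LJ[OF LM(1)] LJ[OF LM(2)] u by blast+
    moreover have "L \<inter> M = {}" using assms(4) LM unfolding pairwise_def disjnt_def by blast
    ultimately have "(u, h L) \<noteq> (u, h M)" "(u, h L) \<in> P" "(u, h M) \<in> P" using LM assms(5) by auto
    from assms(6)[OF this(2,3,1)] show False by simp
  qed
  have hne: "h L \<noteq> h M" if LM: "L \<in> \<L>" "M \<in> \<L>" "L \<noteq> M" for L M
  proof -
    have "h L \<in> snd ` L" "h M \<in> snd ` M" using LJ[OF LM(1)] LJ[OF LM(2)] x[OF LM(1)] x[OF LM(2)] by force+
    then show ?thesis using assms(7)[OF LM] by (metis disjoint_iff)
  qed
  define p where "p L = card {M\<in>\<L>. x M < x L}" for L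
  define q where "q L = card {M\<in>\<L>. h M < h L}" for L
  have pk: "p L < card \<L>" "q L < card \<L>" if "L \<in> \<L>" for L
    unfolding p_def q_def by (rule rank_bound[OF assms(1) that])+
  have pord: "((\<forall>u\<in>J L. \<forall>w\<in>J M. u < w) \<and> p L < p M) \<or> ((\<forall>u\<in>J L. \<forall>w\<in>J M. w < u) \<and> p M < p L)"
    if LM: "L \<in> \<L>" "M \<in> \<L>" "L \<noteq> M" for L M
  proof (cases "x L < x M")
    case True
    then have "p L < p M" unfolding p_def by (rule rank_less[OF assms(1) LM(1)])
    then show ?thesis
      using disjoint_intervals_less[OF J(1)[OF LM(1)] J(1)[OF LM(2)] Jdisj[OF LM] x[OF LM(1)] x[OF LM(2)] True] by blast
  next
    case False
    have "J M \<inter> J L = {}" using Jdisj[OF LM] by blast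
    moreover have lt: "x M < x L" using False x[OF LM(1)] x[OF LM(2)] Jdisj[OF LM] by (metis disjoint_iff linorder_neqE)
    moreover have "p M < p L" unfolding p_def by (rule rank_less[OF assms(1) LM(2) lt])
    ultimately show ?thesis
      using disjoint_intervals_less[OF J(1)[OF LM(2)] J(1)[OF LM(1)] _ x[OF LM(2)] x[OF LM(1)] lt] by blast
  qed
  have qord: "(h L < h M \<and> q L < q M) \<or> (h M < h L \<and> q M < q L)" if LM: "L \<in> \<L>" "M \<in> \<L>" "L \<noteq> M" for L M
    using hne[OF LM] rank_less[OF assms(1) LM(1), of h M] rank_less[OF assms(1) LM(2), of h L]
    unfolding q_def by linarith
  obtain C where C: "\<And>(U :: (nat \<times> nat) set) r a b n. \<lbrakk>finite U; packed U r a b; \<not> occurs \<L> p q U r a b;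
     \<And>u. u \<in> U \<Longrightarrow> r u < n; \<And>u. u \<in> U \<Longrightarrow> b u < n\<rbrakk> \<Longrightarrow> card U \<le> C * n"
    using card_linear_bound[of \<L> p "card \<L>" q, OF pk] by metis
  \<comment> \<open>The row sums contribute \<open>4 * D * real (C + 1) * real N\<close>, the
    integration another \<open>D\<close>, and \<open>real N \<le> 2 * n\<close> the remaining factor
    \<open>2\<close>.\<close>
  define c where "c = 8 * D * D * real (C + 1)"
  have bound: "measure lebesgue S \<le> c * n"
    if n: "n \<ge> 1" and S: "open S" "S \<subseteq> {0..n} \<times> {0..n}" "pattern_free S P" for n S
  proof -
    define N where "N = nat \<lfloor>n / D\<rfloor> + 1"
    have "0 \<le> n / D" using n D(1) by simp
    then have N': "real N = of_int \<lfloor>n / D\<rfloor> + 1" unfolding N_def by simp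
    then have "n / D < real N" by linarith
    then have N: "n < real N * D" using D(1) by (simp add: field_simps)
    have "n / D \<le> n" using n D(1) by (simp add: field_simps)
    then have N2: "real N \<le> 2 * n" using N' n by linarith
    have "measure lebesgue S \<le> (4 * D * real (C + 1) * real N) * D"
    proof (rule measure_le_row_sum[OF S(1,2) _ N])
      show "(\<Sum>j<N. measure lebesgue {x. (x, v + real j * D) \<in> S}) \<le> 4 * D * real (C + 1) * real N" for v
        by (rule pattern_free_row_sum[OF P _ JD hD pord qord C S N]) (use D(1) in auto)
    qed (use D(1) in auto)
    also have "\<dots> = 4 * D * D * real (C + 1) * real N" by simp
    also have "\<dots> \<le> 4 * D * D * real (C + 1) * (2 * n)" using N2 D(1) by (intro mult_left_mono) auto
    finally show ?thesis unfolding c_def by simp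
  qed
  \<comment> \<open>With the empty set admissible, the supremum is over a nonempty set bounded
    above, so \<open>Sup\<close> is not an unspecified value.\<close>
  have free: "pattern_free {} P"
  proof -
    have "P \<noteq> {}" unfolding P using assms(2) x by auto
    then show ?thesis unfolding pattern_contains_def by auto
  qed
  have "norm (opx n P) \<le> c * norm n" if n: "n \<ge> 1" for n
  proof -
    define M where "M = {measure lebesgue S | S. open S \<and> S \<subseteq> {0..n} \<times> {0..n} \<and> pattern_free S P}"
    have 0: "0 \<in> M" unfolding M_def using free by (intro CollectI exI[of _ "{}"]) simp
    have ub: "m \<le> c * n" if "m \<in> M" for m using that bound[OF n] unfolding M_def by blast
    have "0 \<le> Sup M" using 0 ub by (intro cSup_upper bdd_aboveI)
    moreover have "Sup M \<le> c * n" using 0 ub by (intro cSup_least) auto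
    ultimately show ?thesis using n unfolding opx_def M_def by simp
  qed
  then show ?thesis
    by (intro bigoI[where c = c] eventually_mono[OF eventually_ge_at_top[of 1]])
qed

end
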